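(* Assume the Generalized Continuum Hypothesis (GCH). Let $\kappa\le\lambda$ be cardinals with $\omega_2\le\kappa$. Then every hypergraph $\mathcal E$ all of whose edges are subsets of $\lambda$ of cardinality either finite or exactly $\kappa$ (i.e. $\mathcal E\subseteq[\lambda]^{\omega\cup\{\kappa\}}$), and which possesses property $C(2,\omega)$, has a minimal vertex cover.
   Context: A hypergraph is identified with a family $\mathcal E$ of non-empty sets (its edges); its vertex set is $\bigcup\mathcal E$. For a set $A$ and a set $S$ of cardinals, $[A]^{S}=\{B\subseteq A: |B|\in S\}$; here $\omega\cup\{\kappa\}$ is the set of all finite cardinals together with $\kappa$. A hypergraph $\mathcal E$ possesses property $C(k,\rho)$ iff $|\bigcap\mathcal E'|<\rho$ for every set $\mathcal E'\subseteq\mathcal E$ of exactly $k$ distinct edges (so $C(2,\omega)$ means any two distinct edges have finite intersection). A set $Y\subseteq\bigcup\mathcal E$ is a vertex cover of $\mathcal E$ iff $Y\cap E\neq\emptyset$ for every $E\in\mathcal E$; it is a minimal vertex cover iff no proper subset of $Y$ is a vertex cover. *)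

theory Defs
  imports Main
begin

unbundle cardinal_syntax

text \<open>
  Cardinals are represented by cardinal orders (\<^const>\<open>Card_order\<close>), up to \<^const>\<open>ordIso\<close>;
  the underlying set of a cardinal \<open>r\<close> is \<^term>\<open>Field r\<close>.
\<close>

text \<open>
  HOL cannot quantify over types inside a formula, so the generalized continuum hypothesis
  \<open>2\<^sup>\<mu> = \<mu>\<^sup>+\<close> is relative to a universe \<open>'u\<close>: it speaks about all infinite cardinals
  that are realized by a set of elements of \<open>'u\<close>.
\<close>

definition GCH :: "'u itself \<Rightarrow> bool" where
  "GCH (_ :: 'u itself) \<longleftrightarrow> (\<forall>A :: 'u set. infinite A \<longrightarrow> |Pow A| =o cardSuc |A| )"

definition aleph2 :: "nat set set rel" where
  "aleph2 = cardSuc (cardSuc natLeq)"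

definition finite_cardinals :: "'a rel set" where
  "finite_cardinals = {c. Card_order c \<and> finite (Field c)}"

text \<open>\<open>[A]\<^sup>S\<close>, for a set \<open>S\<close> of cardinals.\<close>

definition subsets_of_size :: "'a set \<Rightarrow> 'a rel set \<Rightarrow> 'a set set" where
  "subsets_of_size A S = {B. B \<subseteq> A \<and> (\<exists>c\<in>S. |B| =o c)}"

definition hypergraph :: "'a set set \<Rightarrow> bool" where
  "hypergraph E \<longleftrightarrow> {} \<notin> E"

text \<open>
  \<open>C(k, \<rho>)\<close>, for cardinals \<open>k\<close> and \<open>\<rho>\<close>. For \<open>k = 0\<close> the empty intersection is
  \<^const>\<open>UNIV\<close>, so the definition is meaningful only for \<open>k > 0\<close>.
\<close>

definition property_C :: "'k rel \<Rightarrow> 'r rel \<Rightarrow> 'a set set \<Rightarrow> bool" where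
  "property_C k \<rho> E \<longleftrightarrow> (\<forall>E'. E' \<subseteq> E \<and> |E'| =o k \<longrightarrow> |\<Inter>E'| <o \<rho>)"

definition vertex_cover :: "'a set set \<Rightarrow> 'a set \<Rightarrow> bool" where
  "vertex_cover E Y \<longleftrightarrow> Y \<subseteq> \<Union>E \<and> (\<forall>e\<in>E. Y \<inter> e \<noteq> {})"

definition minimal_vertex_cover :: "'a set set \<Rightarrow> 'a set \<Rightarrow> bool" where
  "minimal_vertex_cover E Y \<longleftrightarrow> vertex_cover E Y \<and> (\<forall>Z. Z \<subset> Y \<longrightarrow> \<not> vertex_cover E Z)"

end

theory Submission
  imports Defs "HOL-Library.Countable_Set_Type"
begin

text \<open>
  A partial solution is a pair \<open>(X, Y)\<close> of disjoint sets of vertices excluded from, respectively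
  included in, the cover, where \<open>X\<close> contains no finite edge and each \<open>y \<in> Y\<close> has an edge contained in
  \<open>insert y X\<close> witnessing that \<open>y\<close> cannot be dropped. By Zorn's lemma it extends to a minimal cover
  as soon as \<open>Y\<close> meets all infinite edges. One infinite edge \<open>A\<close> that is not contained in \<open>X\<close> can always
  be met: either some finite edge can be used as witness for a vertex of \<open>A\<close>, at the cost of
  finitely many vertices, or no vertex of \<open>A\<close> matters for the finite edges, and \<open>A\<close> itself
  becomes the witness for one of its vertices.

  The infinite edges have to be met in an order for which no unmet edge ever gets swallowed by \<open>X\<close>.
  By induction on \<open>|S| \<ge> \<kappa>\<close>, every partial solution can be enlarged so that \<open>X\<close> grows only inside
  some \<open>W \<supseteq> S\<close> with \<open>|W| = |S|\<close>, and all edges with uncountable trace on \<open>W\<close> are met.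
  The set \<open>W\<close> is the union of a chain, indexed by \<open>|S|\<close>, of smaller sets. An edge with uncountable
  trace on \<open>W\<close> has infinite trace on a member of the chain, and by GCH and almost disjointness each
  member has at most \<open>|S|\<close> such edges, so that all of them can be scheduled.
  If \<open>|S| = \<kappa>\<close>, each stage meets a single edge; the fewer than \<open>\<kappa>\<close> edges used before exclude fewer
  than \<open>\<kappa>\<close> vertices of it. If \<open>|S| > \<kappa>\<close>, each stage uses the induction hypothesis; unmet edges have
  countable traces on the members of the chain, hence at most \<open>\<omega>\<^sub>1\<close> of their vertices are newly
  excluded at any intermediate stage, which is harmless since \<open>\<kappa> \<ge> \<omega>\<^sub>2\<close>.
\<close>

subsection \<open>Cardinal orders\<close>

lemma Card_order_ordLess_if_not_ordLeq:
  assumes "Card_order r" "Card_order r'" "\<not> r' \<le>o r"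
  shows "r <o r'"
proof -
  have "Well_order r" "Well_order r'" using assms(1,2) by (auto intro: card_order_on_well_order_on)
  then show ?thesis using assms(3) not_ordLeq_iff_ordLess by blast
qed

lemma card_of_under_ordLess:
  assumes "infinite S" "a \<in> S"
  shows "|under ( |S| ) a| <o |S|"
proof -
  have "underS ( |S| ) a \<union> {a} = under ( |S| ) a"
    using assms card_of_Well_order[of S]
    by (auto simp: underS_def under_def order_on_defs refl_on_def Field_card_of)
  moreover have "|underS ( |S| ) a| <o |S|"
    using assms card_of_underS[OF card_of_Card_order, of a S] by (simp add: Field_card_of)
  moreover have "|{a}| <o |S|"
    using assms by (intro finite_ordLess_infinite) (simp_all add: Field_card_of card_of_well_order_on)
  ultimately show ?thesis
    using card_of_Un_ordLess_infinite[OF assms(1)] by metis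
qed

text \<open>Serves to schedule a task found at stage \<open>j\<close> for a strictly later stage.
  Under a bijection of \<open>S\<close> with \<open>S \<times> S \<times> S\<close>, each pair
  \<open>(j, k)\<close> has \<open>|S|\<close> preimages, too many to fit into the initial segment
  up to \<open>j\<close>.\<close>

lemma unbounded_pairing:
  assumes "infinite S"
  obtains p where "\<And>j k. j \<in> S \<Longrightarrow> k \<in> S \<Longrightarrow> \<exists>i\<in>S. j \<in> underS ( |S| ) i \<and> p i = (j, k)"
proof -
  have "|S \<times> S| =o |S|" using assms by (rule card_of_Times_same_infinite)
  moreover from this have "|S \<times> S \<times> S| =o |S|"
    using assms card_of_Times_infinite_simps(1)[of S "S \<times> S"] ordIso_imp_ordLeq
    by (metis Times_empty finite.emptyI)
  ultimately obtain b where b: "bij_betw b S (S \<times> S \<times> S)"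
    using card_of_ordIso ordIso_symmetric by blast
  show ?thesis
  proof (rule that[of "snd \<circ> b"])
    fix j k assume jk: "j \<in> S" "k \<in> S"
    let ?\<Phi> = "{i \<in> S. snd (b i) = (j, k)}"
    have inv: "b (inv_into S b (x, j, k)) = (x, j, k) \<and> inv_into S b (x, j, k) \<in> S" if "x \<in> S" for x
    proof -
      have "(x, j, k) \<in> b ` S" using b jk that by (simp add: bij_betw_def)
      then show ?thesis by (simp add: f_inv_into_f inv_into_into)
    qed
    then have "inj_on (\<lambda>x. inv_into S b (x, j, k)) S"
      by (intro inj_on_inverseI[of _ "\<lambda>y. fst (b y)"]) simp
    moreover have "(\<lambda>x. inv_into S b (x, j, k)) ` S \<subseteq> ?\<Phi>" using inv by auto
    ultimately have "|S| \<le>o |?\<Phi>|" unfolding card_of_ordLeq[symmetric] by blast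
    then have "\<not> ?\<Phi> \<subseteq> under ( |S| ) j"
      using not_ordLess_ordLeq[OF card_of_under_ordLess[OF assms jk(1)]]
        ordLeq_transitive[OF _ card_of_mono1] by blast
    then obtain i where i: "i \<in> S" "snd (b i) = (j, k)" "(i, j) \<notin> |S|"
      by (auto simp: under_def)
    have "(j, j) \<in> |S|" and total: "i = j \<or> (i, j) \<in> |S| \<or> (j, i) \<in> |S|"
      using i jk card_of_Well_order[of S]
      unfolding order_on_defs total_on_def refl_on_def Field_card_of by blast+
    then have "(j, i) \<in> |S|" "j \<noteq> i" using i(3) by auto
    then show "\<exists>i\<in>S. j \<in> underS ( |S| ) i \<and> (snd \<circ> b) i = (j, k)"
      using i by (auto simp: underS_def)
  qed
qed

text \<open>Two members of such a chain with equally many elements coincide, so \<open>card\<close>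
  embeds the chain into the natural numbers.\<close>

lemma countable_Union_chain_finite:
  assumes "\<And>C D. C \<in> \<C> \<Longrightarrow> D \<in> \<C> \<Longrightarrow> C \<subseteq> D \<or> D \<subseteq> C"
    and fin: "\<And>C. C \<in> \<C> \<Longrightarrow> finite C"
  shows "countable (\<Union>\<C>)"
proof -
  have "C = D" if "C \<in> \<C>" "D \<in> \<C>" "card C = card D" for C D
    using assms(1)[OF that(1,2)] fin that by (metis card_subset_eq)
  then have "inj_on card \<C>" by (auto intro: inj_onI)
  then have "countable \<C>" using countableI by blast
  then show ?thesis using fin countable_UN[of \<C> "\<lambda>C. C"] by (simp add: countable_finite)
qed

text \<open>If the union were larger, it would contain a set \<open>D\<close> of size exactly
  \<open>cardSuc r\<close>. No member of the chain includes \<open>D\<close>, so each member misses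
  some \<open>d\<close> in \<open>D\<close> and lies below the chosen member \<open>c d\<close> that
  contains \<open>d\<close>. Hence the sets \<open>c d\<close> already exhaust the union, and there
  are only \<open>cardSuc r\<close> of them, each of size at most \<open>r\<close>.\<close>

lemma card_Union_chain_ordLeq_cardSuc:
  assumes chain: "\<And>C D. C \<in> \<C> \<Longrightarrow> D \<in> \<C> \<Longrightarrow> C \<subseteq> D \<or> D \<subseteq> C"
    and r: "Card_order r" "infinite (Field r)"
    and small: "\<And>C. C \<in> \<C> \<Longrightarrow> |C| \<le>o r"
  shows "|\<Union>\<C>| \<le>o cardSuc r"
proof (rule ccontr)
  let ?s = "cardSuc r"
  have s: "Card_order ?s" "infinite (Field ?s)" using r by (auto simp: cardSuc_finite cardSuc_Card_order)
  assume "\<not> |\<Union>\<C>| \<le>o ?s"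
  then have less: "?s <o |\<Union>\<C>|"
    by (intro Card_order_ordLess_if_not_ordLeq s(1) card_of_Card_order)
  then have "|Field ?s| \<le>o |\<Union>\<C>|"
    by (intro ordIso_ordLeq_trans[OF card_of_Field_ordIso[OF s(1)]] ordLess_imp_ordLeq)
  then obtain D where D: "D \<subseteq> \<Union>\<C>" "|Field ?s| =o |D|"
    using internalize_card_of_ordLeq2[THEN iffD1] by blast
  then have "?s =o |D|"
    by (intro ordIso_transitive[OF ordIso_symmetric[OF card_of_Field_ordIso[OF s(1)]]])
  note D = D(1) this
  have "\<forall>d\<in>D. \<exists>C\<in>\<C>. d \<in> C" using D by auto
  then obtain c where c: "\<And>d. d \<in> D \<Longrightarrow> c d \<in> \<C> \<and> d \<in> c d" by metis
  have "\<Union>\<C> \<subseteq> (\<Union>d\<in>D. c d)"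
  proof
    fix x assume "x \<in> \<Union>\<C>"
    then obtain C where C: "C \<in> \<C>" "x \<in> C" by auto
    have "\<not> D \<subseteq> C"
    proof
      assume "D \<subseteq> C"
      then have "|D| \<le>o r" by (rule ordLeq_transitive[OF card_of_mono1 small[OF C(1)]])
      then show False
        using not_ordLess_ordLeq[OF cardSuc_greater[OF r(1)]] ordIso_ordLeq_trans[OF D(2)] by blast
    qed
    then obtain d where "d \<in> D" "d \<notin> C" by auto
    then show "x \<in> (\<Union>d\<in>D. c d)" using chain[OF C(1), of "c d"] c[of d] C(2) by blast
  qed
  moreover have "|\<Union>d\<in>D. c d| \<le>o ?s"
  proof (rule card_of_UNION_ordLeq_infinite_Field[OF s(2,1)])
    show "|D| \<le>o ?s" by (rule ordIso_imp_ordLeq[OF ordIso_symmetric[OF D(2)]])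
    show "\<forall>d\<in>D. |c d| \<le>o ?s" 
      by (intro ballI ordLeq_transitive[OF small cardSuc_ordLeq[OF r(1)]]) (simp add: c)
  qed
  ultimately have "|\<Union>\<C>| \<le>o ?s" by (rule ordLeq_transitive[OF card_of_mono1])
  then show False using not_ordLess_ordLeq[OF less] by blast
qed

lemma under_card_of_subset: "under ( |S| ) i \<subseteq> S" "underS ( |S| ) i \<subseteq> S"
  using FieldI1[of _ i "|S|"] by (auto simp: under_def underS_def Field_card_of)

lemma under_card_of_self: "i \<in> S \<Longrightarrow> i \<in> under ( |S| ) i"
  using card_of_Well_order[of S] by (auto simp: under_def order_on_defs refl_on_def Field_card_of)

lemma underS_card_of_total:
  "i \<in> S \<Longrightarrow> j \<in> S \<Longrightarrow> i = j \<or> i \<in> underS ( |S| ) j \<or> j \<in> underS ( |S| ) i"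
  using card_of_Well_order[of S]
  by (auto simp: underS_def order_on_defs total_on_def Field_card_of)

lemma underS_card_of_subset_under: "underS ( |S| ) i \<subseteq> under ( |S| ) i"
  by (auto simp: under_def underS_def)

lemma under_card_of_mono: "j \<in> under ( |S| ) i \<Longrightarrow> under ( |S| ) j \<subseteq> under ( |S| ) i"
  using card_of_Well_order[of S] by (auto simp: under_def order_on_defs trans_def)

lemma under_card_of_subset_underS: "j \<in> underS ( |S| ) i \<Longrightarrow> under ( |S| ) j \<subseteq> underS ( |S| ) i"
  using card_of_Well_order[of S]
  by (auto simp: under_def underS_def order_on_defs) (metis antisymD, metis transD)

lemma wf_underS_card_of: "wf {(j, i). j \<in> underS ( |S| ) i}"
proof -
  have "{(j, i). j \<in> underS ( |S| ) i} = |S| - Id" by (auto simp: underS_def)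
  then show ?thesis using card_of_Well_order[of S] by (simp add: well_order_on_def)
qed

text \<open>Regularity of \<open>|S|\<close> is not assumed: countable pieces yield a union of size
  at most the maximum of \<open>|I|\<close> and \<open>natLeq\<close>, both of which are below
  \<open>|S|\<close>.\<close>

lemma card_UN_countable_ordLess:
  assumes "uncountable S" "|I| <o |S|" "\<And>i. i \<in> I \<Longrightarrow> countable (A i)"
  shows "|\<Union>i\<in>I. A i| <o |S|"
proof (cases "countable I")
  case True
  then have "countable (\<Union>i\<in>I. A i)" using assms(3) by blast
  then have "|\<Union>i\<in>I. A i| \<le>o natLeq" by (simp add: countable_card_le_natLeq)
  moreover have "natLeq <o |S|"
    using assms(1) by (intro Card_order_ordLess_if_not_ordLeq natLeq_Card_order card_of_Card_order)
      (simp flip: countable_card_le_natLeq)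
  ultimately show ?thesis by (rule ordLeq_ordLess_trans)
next
  case False
  then have inf: "infinite I" by (metis countable_finite)
  then have "natLeq \<le>o |I|" using infinite_iff_natLeq_ordLeq[of I] by simp
  then have "|A i| \<le>o |I|" if "i \<in> I" for i
    by (rule ordLeq_transitive[OF assms(3)[OF that, unfolded countable_card_le_natLeq]])
  then have "|\<Union>i\<in>I. A i| \<le>o |I|" using inf by (intro card_of_UNION_ordLeq_infinite) (auto intro: card_of_mono1)
  then show ?thesis using assms(2) by (rule ordLeq_ordLess_trans)
qed

lemma card_Times_self_ordLess:
  assumes "infinite S" "|I| <o |S|"
  shows "|I \<times> I| <o |S|"
proof (cases "finite I")
  case True
  then show ?thesis
    using assms(1) by (intro finite_ordLess_infinite) (simp_all add: Field_card_of card_of_well_order_on)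
next
  case False
  then show ?thesis by (rule ordIso_ordLess_trans[OF card_of_Times_same_infinite assms(2)])
qed

subsection \<open>Partial covers\<close>

definition partial_cover :: "'a set set \<Rightarrow> 'a set \<Rightarrow> 'a set \<Rightarrow> bool" where
  "partial_cover E X Y \<longleftrightarrow> X \<inter> Y = {} \<and> (\<forall>e\<in>E. finite e \<longrightarrow> \<not> e \<subseteq> X) \<and>
     (\<forall>y\<in>Y. \<exists>e\<in>E. y \<in> e \<and> e - {y} \<subseteq> X)"

lemma partial_coverI:
  assumes "X \<inter> Y = {}" "\<And>e. e \<in> E \<Longrightarrow> finite e \<Longrightarrow> \<not> e \<subseteq> X"
    "\<And>y. y \<in> Y \<Longrightarrow> \<exists>e\<in>E. y \<in> e \<and> e - {y} \<subseteq> X"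
  shows "partial_cover E X Y"
  using assms by (simp add: partial_cover_def)

lemma partial_coverD:
  assumes "partial_cover E X Y"
  shows "X \<inter> Y = {}" "\<And>e. e \<in> E \<Longrightarrow> finite e \<Longrightarrow> \<not> e \<subseteq> X"
    "\<And>y. y \<in> Y \<Longrightarrow> \<exists>e\<in>E. y \<in> e \<and> e - {y} \<subseteq> X"
  using assms by (simp_all add: partial_cover_def)

text \<open>The conditions have finite character: a finite edge inside the union of a chain lies
  inside one member, and a witness edge stays a witness when \<open>X\<close> grows. Including the
  base pair makes the empty index set, that is, the first stage of a recursion, a legitimate
  case.\<close>

lemma partial_cover_UN:
  assumes XY: "partial_cover E X Y"
    and ext: "\<And>i. i \<in> I \<Longrightarrow> partial_cover E (Xs i) (Ys i) \<and> X \<subseteq> Xs i \<and> Y \<subseteq> Ys i"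
    and chain: "\<And>i j. i \<in> I \<Longrightarrow> j \<in> I \<Longrightarrow>
      Xs i \<subseteq> Xs j \<and> Ys i \<subseteq> Ys j \<or> Xs j \<subseteq> Xs i \<and> Ys j \<subseteq> Ys i"
  shows "partial_cover E (X \<union> (\<Union>i\<in>I. Xs i)) (Y \<union> (\<Union>i\<in>I. Ys i))"
proof (cases "I = {}")
  case True
  then show ?thesis using XY by simp
next
  case False
  have eqs: "X \<union> (\<Union>i\<in>I. Xs i) = (\<Union>i\<in>I. Xs i)" "Y \<union> (\<Union>i\<in>I. Ys i) = (\<Union>i\<in>I. Ys i)"
    using False ext by blast+
  have disj: "Xs i \<inter> Ys j = {}" if "i \<in> I" "j \<in> I" for i j
  proof -
    have "Xs i \<inter> Ys i = {}" "Xs j \<inter> Ys j = {}" using ext that by (blast dest: partial_coverD(1))+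
    then show ?thesis using chain[OF that] by blast
  qed
  have "\<not> e \<subseteq> (\<Union>i\<in>I. Xs i)" if e: "e \<in> E" "finite e" for e
  proof
    assume "e \<subseteq> (\<Union>i\<in>I. Xs i)"
    moreover have "subset.chain UNIV (Xs ` I)"
      using chain by (auto simp: subset_chain_def)
    ultimately obtain B where "B \<in> Xs ` I" "e \<subseteq> B"
      using finite_subset_Union_chain[OF e(2), of "Xs ` I" UNIV] False by blast
    then obtain i where "i \<in> I" "e \<subseteq> Xs i" by blast
    then show False using ext[of i] partial_coverD(2)[of E "Xs i" "Ys i" e] e by blast
  qed
  moreover have "\<exists>e\<in>E. y \<in> e \<and> e - {y} \<subseteq> (\<Union>i\<in>I. Xs i)" if y: "y \<in> (\<Union>i\<in>I. Ys i)" for y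
  proof -
    obtain i where i: "i \<in> I" "y \<in> Ys i" using y by auto
    then obtain e where "e \<in> E" "y \<in> e" "e - {y} \<subseteq> Xs i"
      using ext[of i] partial_coverD(3)[of E "Xs i" "Ys i" y] by blast
    then show ?thesis using i(1) by blast
  qed
  moreover have "(\<Union>i\<in>I. Xs i) \<inter> (\<Union>i\<in>I. Ys i) = {}" using disj by fast
  ultimately show ?thesis unfolding eqs by (intro partial_coverI) simp_all
qed

text \<open>The set \<open>F\<close> absorbs what \<open>X\<close> gains outside \<open>A\<close>.
  In the first case a finite edge \<open>e\<close> through \<open>a\<close> becomes the witness for
  \<open>a\<close>, and only finitely many vertices are excluded. In the second case no finite edge
  lies in \<open>X \<union> A\<close>, so all of \<open>A - {a}\<close> can be excluded and
  \<open>A\<close> witnesses \<open>a\<close>.\<close>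

lemma extend_partial_cover:
  assumes XY: "partial_cover E X Y" and A: "A \<in> E" "A \<inter> Y = {}" "\<not> A \<subseteq> X"
  obtains X' Y' F where "partial_cover E X' Y'" "X \<subseteq> X'" "Y \<subseteq> Y'" "X' \<subseteq> X \<union> A \<union> F"
    "finite F" "A \<inter> Y' \<noteq> {}"
proof (cases "\<exists>a\<in>A - X. \<exists>e\<in>E. finite e \<and> a \<in> e \<and> e \<inter> Y = {} \<and>
    (\<forall>f\<in>E. finite f \<longrightarrow> \<not> f \<subseteq> X \<union> (e - {a}))")
  case True
  then obtain a e where ae: "a \<in> A - X" "e \<in> E" "finite e" "a \<in> e" "e \<inter> Y = {}"
    "\<forall>f\<in>E. finite f \<longrightarrow> \<not> f \<subseteq> X \<union> (e - {a})" by blast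
  show ?thesis
  proof (rule that)
    show "partial_cover E (X \<union> (e - {a})) (insert a Y)"
    proof (rule partial_coverI)
      show "(X \<union> (e - {a})) \<inter> insert a Y = {}" using partial_coverD(1)[OF XY] ae by blast
      show "\<not> f \<subseteq> X \<union> (e - {a})" if "f \<in> E" "finite f" for f using ae(6) that by blast
      fix y assume "y \<in> insert a Y"
      then show "\<exists>f\<in>E. y \<in> f \<and> f - {y} \<subseteq> X \<union> (e - {a})"
        using partial_coverD(3)[OF XY, of y] ae by blast
    qed
  qed (use ae in auto)
next
  case False
  obtain a where a: "a \<in> A - X" using A by blast
  \<comment> \<open>Infinite descent: a finite edge \<open>e\<close> inside
    \<open>X \<union> A\<close> contains some \<open>b\<close> in \<open>A - X\<close>. As
    \<open>b\<close> and \<open>e\<close> fail the case condition, there is a finite edge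
    \<open>f\<close> within \<open>X \<union> (e - {b})\<close>, which has fewer vertices outside
    \<open>X\<close>.\<close>
  have "\<not> e \<subseteq> X \<union> A" if "e \<in> E" "finite e" for e
    using that
  proof (induction "card (e - X)" arbitrary: e rule: less_induct)
    case less
    show ?case
    proof
      assume e: "e \<subseteq> X \<union> A"
      then obtain b where b: "b \<in> e" "b \<in> A - X"
        using partial_coverD(2)[OF XY less.prems] by blast
      have "e \<inter> Y = {}" using e A partial_coverD(1)[OF XY] by blast
      then obtain f where f: "f \<in> E" "finite f" "f \<subseteq> X \<union> (e - {b})"
        using False b less.prems by blast
      have "f - X \<subset> e - X" using f b by blast
      then have "card (f - X) < card (e - X)" using less.prems by (meson finite_Diff psubset_card_mono)
      then show False using less.hyps[OF _ f(1,2)] f(3) e by blast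
    qed
  qed
  then have indep: "\<not> e \<subseteq> X \<union> (A - {a})" if "e \<in> E" "finite e" for e using that by blast
  have "partial_cover E (X \<union> (A - {a})) (insert a Y)"
  proof (rule partial_coverI[OF _ indep])
    show "(X \<union> (A - {a})) \<inter> insert a Y = {}" using partial_coverD(1)[OF XY] A a by blast
    fix y assume "y \<in> insert a Y"
    then show "\<exists>e\<in>E. y \<in> e \<and> e - {y} \<subseteq> X \<union> (A - {a})"
      using partial_coverD(3)[OF XY, of y] A a by blast
  qed
  then show ?thesis by (rule that[where F = "{}"]) (use a in auto)
qed

text \<open>The cover is the complement of a maximal \<open>M\<close> that extends \<open>X\<close>,
  avoids \<open>Y\<close> and contains no finite edge. A vertex outside both \<open>M\<close> and
  \<open>Y\<close> gets its private edge from maximality, since adding it to \<open>M\<close> would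
  swallow a finite edge; a vertex of \<open>Y\<close> keeps the witness it had.\<close>

lemma minimal_vertex_cover_if_partial_cover:
  assumes XY: "partial_cover E X Y" and inf: "\<And>A. A \<in> E \<Longrightarrow> infinite A \<Longrightarrow> A \<inter> Y \<noteq> {}"
  shows "\<exists>Z. minimal_vertex_cover E Z"
proof -
  let ?\<I> = "{M. X \<subseteq> M \<and> M \<inter> Y = {} \<and> (\<forall>e\<in>E. finite e \<longrightarrow> \<not> e \<subseteq> M)}"
  have X: "X \<in> ?\<I>" using XY unfolding partial_cover_def by auto
  have "\<exists>M\<in>?\<I>. \<forall>N\<in>?\<I>. M \<subseteq> N \<longrightarrow> N = M"
  proof (rule subset_Zorn_nonempty)
    show "?\<I> \<noteq> {}" using X by blast
  next
    fix \<C> assume \<C>: "\<C> \<noteq> {}" "subset.chain ?\<I> \<C>"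
    then have sub: "\<C> \<subseteq> ?\<I>" by (simp add: subset_chain_def)
    have "\<not> e \<subseteq> \<Union>\<C>" if e: "e \<in> E" "finite e" for e
    proof
      assume "e \<subseteq> \<Union>\<C>"
      then obtain M where "M \<in> \<C>" "e \<subseteq> M" using finite_subset_Union_chain[OF e(2) _ \<C>] by blast
      then show False using sub e by blast
    qed
    then show "\<Union>\<C> \<in> ?\<I>" using \<C>(1) sub by blast
  qed
  then obtain M where "M \<in> ?\<I>" and max: "\<forall>N\<in>?\<I>. M \<subseteq> N \<longrightarrow> N = M" by (elim bexE)
  then have M: "X \<subseteq> M" "M \<inter> Y = {}" "\<forall>e\<in>E. finite e \<longrightarrow> \<not> e \<subseteq> M" by simp_all
  have cover: "vertex_cover E (\<Union>E - M)"
    unfolding vertex_cover_def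
  proof (intro conjI ballI)
    fix e assume e: "e \<in> E"
    have "e \<subseteq> M \<Longrightarrow> infinite e" using M e by blast
    then show "(\<Union>E - M) \<inter> e \<noteq> {}" using inf[OF e] M e by blast
  qed blast
  have own_edge: "\<exists>e\<in>E. y \<in> e \<and> e - {y} \<subseteq> M" if y: "y \<in> \<Union>E - M" for y
  proof (cases "y \<in> Y")
    case True
    then show ?thesis using partial_coverD(3)[OF XY, of y] M(1) by blast
  next
    case False
    have "insert y M \<notin> ?\<I>" using bspec[OF max, of "insert y M"] y by blast
    moreover have "X \<subseteq> insert y M" "insert y M \<inter> Y = {}" using False M(1,2) by auto
    ultimately obtain e where e: "e \<in> E" "e \<subseteq> insert y M" "finite e" by auto
    then have "\<not> e \<subseteq> M" using M(3) by simp
    then have "y \<in> e" "e - {y} \<subseteq> M" using e(2) by auto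
    then show ?thesis using e(1) by blast
  qed
  have "\<not> vertex_cover E Z" if Z: "Z \<subset> \<Union>E - M" for Z
  proof -
    obtain y where "y \<in> \<Union>E - M" "y \<notin> Z" using Z by blast
    then show ?thesis using own_edge[of y] Z unfolding vertex_cover_def by blast
  qed
  then show ?thesis using cover unfolding minimal_vertex_cover_def by blast
qed

subsection \<open>Transfinite construction with bookkeeping\<close>

text \<open>Being strictly above \<open>cardSuc natLeq\<close> is the form in which
  \<open>kap\<close> is at least omega_2. The last assumption is the form in which GCH enters,
  restricted to sets of vertices.\<close>

locale almost_disjoint_hypergraph =
  fixes E :: "'a set set" and kap :: "'a rel"
  assumes kap: "Card_order kap" "cardSuc natLeq <o kap"
    and card_edge: "A \<in> E \<Longrightarrow> infinite A \<Longrightarrow> |A| =o kap"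
    and almost_disjoint:
      "A \<in> E \<Longrightarrow> B \<in> E \<Longrightarrow> infinite A \<Longrightarrow> infinite B \<Longrightarrow> A \<noteq> B \<Longrightarrow> finite (A \<inter> B)"
    and card_Pow: "infinite U \<Longrightarrow> |U| <o |S| \<Longrightarrow> |Pow (U :: 'a set)| \<le>o |S :: 'a set|"
begin

definition big :: "'a set set" where
  "big = {A \<in> E. infinite A}"

lemma infinite_kap: "infinite (Field kap)"
proof -
  have "natLeq \<le>o kap"
    by (rule ordLess_imp_ordLeq[OF ordLess_transitive[OF cardSuc_greater[OF natLeq_Card_order] kap(2)]])
  then have "natLeq \<le>o |Field kap|"
    by (rule ordLeq_ordIso_trans[OF _ ordIso_symmetric[OF card_of_Field_ordIso[OF kap(1)]]])
  then show ?thesis using infinite_iff_natLeq_ordLeq[of "Field kap"] by simp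
qed

lemma uncountable_if_kap_ordLeq:
  assumes "kap \<le>o |A|"
  shows "uncountable A"
proof
  assume "countable A"
  then have "kap \<le>o natLeq"
    unfolding countable_card_le_natLeq by (rule ordLeq_transitive[OF assms])
  then show False
    using not_ordLess_ordLeq[OF ordLess_transitive[OF cardSuc_greater[OF natLeq_Card_order] kap(2)]]
    by blast
qed

text \<open>By almost disjointness an infinite edge is determined by its trace on \<open>U\<close>
  once that trace is infinite. So there are at most \<open>|Pow U|\<close> such edges, hence at most
  \<open>|S|\<close> by \<open>card_Pow\<close>.\<close>

lemma enumerate_big_traces:
  assumes "big \<noteq> {}" "S \<noteq> {}" "|U| <o |S :: 'a set|"
  obtains g where "g ` S \<subseteq> big" "\<And>A. A \<in> big \<Longrightarrow> infinite (A \<inter> U) \<Longrightarrow> A \<in> g ` S"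
proof (cases "\<exists>A\<in>big. infinite (A \<inter> U)")
  case False
  obtain B where "B \<in> big" using assms(1) by blast
  then show ?thesis using False by (intro that[of "\<lambda>_. B"]) auto
next
  case True
  let ?T = "{A \<in> big. infinite (A \<inter> U)}"
  have "infinite U" using True by blast
  have "A = B" if "A \<in> ?T" "B \<in> ?T" "A \<inter> U = B \<inter> U" for A B
  proof (rule ccontr)
    assume "A \<noteq> B"
    then have "finite (A \<inter> B)" using almost_disjoint that by (auto simp: big_def)
    moreover have "A \<inter> U \<subseteq> A \<inter> B" using that by blast
    ultimately show False using that finite_subset by blast
  qed
  then have "inj_on (\<lambda>A. A \<inter> U) ?T" by (auto intro!: inj_onI)
  then have "|?T| \<le>o |Pow U|" unfolding card_of_ordLeq[symmetric] by blast
  then have "|?T| \<le>o |S|" using card_Pow[OF \<open>infinite U\<close> assms(3)] ordLeq_transitive by blast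
  then obtain g where "g ` S = ?T" using True card_of_ordLeq2[of ?T S] by blast
  then show ?thesis by (intro that[of g]) auto
qed

text \<open>\<open>T f j\<close> stands for the set of vertices collected up to stage \<open>j\<close>, and \<open>b i\<close> for the edge to be
  met at stage \<open>i\<close>.\<close>

lemma bookkept_recursion:
  fixes T :: "('a \<Rightarrow> 'd) \<Rightarrow> 'a \<Rightarrow> 'a set" and Q :: "('a \<Rightarrow> 'd) \<Rightarrow> 'a \<Rightarrow> 'a set \<Rightarrow> 'd \<Rightarrow> bool"
  assumes S: "infinite S" and big: "big \<noteq> {}"
    and T: "\<And>f g j. j \<in> S \<Longrightarrow> (\<And>l. l \<in> under ( |S| ) j \<Longrightarrow> f l = g l) \<Longrightarrow> T f j = T g j"
    and Q: "\<And>f g i B q. (\<And>l. l \<in> underS ( |S| ) i \<Longrightarrow> f l = g l) \<Longrightarrow> Q f i B q = Q g i B q"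
    and step: "\<And>f b i B. i \<in> S \<Longrightarrow> B \<in> big \<Longrightarrow>
      (\<And>j. j \<in> underS ( |S| ) i \<Longrightarrow> b j \<in> big \<and> Q f j (b j) (f j)) \<Longrightarrow> \<exists>q. Q f i B q"
  obtains f b where "\<And>i. i \<in> S \<Longrightarrow> b i \<in> big \<and> Q f i (b i) (f i)"
    "\<And>j A. j \<in> S \<Longrightarrow> A \<in> big \<Longrightarrow> |T f j| <o |S| \<Longrightarrow> infinite (A \<inter> T f j) \<Longrightarrow> \<exists>i\<in>S. b i = A"
proof -
  obtain B0 where B0: "B0 \<in> big" using big by blast
  obtain p where p: "\<And>j k. j \<in> S \<Longrightarrow> k \<in> S \<Longrightarrow> \<exists>i\<in>S. j \<in> underS ( |S| ) i \<and> p i = (j, k)"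
    using unbounded_pairing[OF S] by metis
  have "\<forall>U :: 'a set. \<exists>g. |U| <o |S| \<longrightarrow> g ` S \<subseteq> big \<and> (\<forall>A\<in>big. infinite (A \<inter> U) \<longrightarrow> A \<in> g ` S)"
  proof
    fix U :: "'a set"
    show "\<exists>g. |U| <o |S| \<longrightarrow> g ` S \<subseteq> big \<and> (\<forall>A\<in>big. infinite (A \<inter> U) \<longrightarrow> A \<in> g ` S)"
    proof (cases "|U| <o |S|")
      case True
      then show ?thesis using enumerate_big_traces[OF big infinite_imp_nonempty[OF S] True] by metis
    qed auto
  qed
  then obtain G where G: "\<And>U. |U| <o |S| \<Longrightarrow> G U ` S \<subseteq> big \<and>
      (\<forall>A\<in>big. infinite (A \<inter> U) \<longrightarrow> A \<in> G U ` S)" by metis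
  \<comment> \<open>The code \<open>p i = (j, k)\<close> asks for the \<open>k\<close>-th edge with
    infinite trace on the set collected at stage \<open>j\<close>. The default \<open>B0\<close>
    covers codes with \<open>j\<close> not earlier than \<open>i\<close>, and sets too large for
    \<open>G\<close> to be meaningful.\<close>
  define target where "target f i = (let B = G (T f (fst (p i))) (snd (p i)) in
    if fst (p i) \<in> underS ( |S| ) i \<and> B \<in> big then B else B0)" for f i
  have target_big: "target f i \<in> big" for f i
    using B0 by (auto simp: target_def Let_def)
  have target_cong: "target f i = target g i"
    if "\<And>l. l \<in> underS ( |S| ) i \<Longrightarrow> f l = g l" for f g i
  proof (cases "fst (p i) \<in> underS ( |S| ) i")
    case True
    then have "T f (fst (p i)) = T g (fst (p i))"
      by (intro T that subsetD[OF under_card_of_subset_underS[OF True]]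
          subsetD[OF under_card_of_subset(2) True])
    then show ?thesis by (simp add: target_def)
  qed (simp add: target_def)
  have "\<exists>f. \<forall>i. i \<in> S \<longrightarrow> Q f i (target f i) (f i)"
  proof (rule dependent_wf_choice[OF wf_underS_card_of[of S]])
    fix f g :: "'a \<Rightarrow> 'd" and i q
    assume "\<And>l. (l, i) \<in> {(j, i). j \<in> underS ( |S| ) i} \<Longrightarrow> f l = g l"
    then have eq: "\<And>l. l \<in> underS ( |S| ) i \<Longrightarrow> f l = g l" by simp
    show "(i \<in> S \<longrightarrow> Q f i (target f i) q) = (i \<in> S \<longrightarrow> Q g i (target g i) q)"
      using Q[OF eq] target_cong[OF eq] by simp
  next
    fix f i
    assume "\<And>j. (j, i) \<in> {(j, i). j \<in> underS ( |S| ) i} \<Longrightarrow> j \<in> S \<longrightarrow> Q f j (target f j) (f j)"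
    then have "target f j \<in> big \<and> Q f j (target f j) (f j)" if "j \<in> underS ( |S| ) i" for j
      using that target_big under_card_of_subset(2)[of S i] by blast
    then show "\<exists>q. i \<in> S \<longrightarrow> Q f i (target f i) q"
      using step[of i "target f i" "target f" f] target_big by blast
  qed
  then obtain f where f: "\<And>i. i \<in> S \<Longrightarrow> Q f i (target f i) (f i)" by blast
  show ?thesis
  proof (rule that[of "target f" f])
    show "target f i \<in> big \<and> Q f i (target f i) (f i)" if "i \<in> S" for i
      using f[OF that] target_big by blast
    show "\<exists>i\<in>S. target f i = A"
      if A: "j \<in> S" "A \<in> big" "|T f j| <o |S|" "infinite (A \<inter> T f j)" for j A
    proof -
      obtain k where k: "k \<in> S" "A = G (T f j) k" using G[OF A(3)] A by blast
      obtain i where "i \<in> S" "j \<in> underS ( |S| ) i" "p i = (j, k)" using p A(1) k(1) by blast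
      then have "target f i = A" using k A by (simp add: target_def)
      then show ?thesis using \<open>i \<in> S\<close> by blast
    qed
  qed
qed

subsection \<open>Absorbing a set of vertices\<close>

text \<open>Infinite edges have size \<open>kap\<close>, so the trace condition keeps every unmet
  one from being contained in \<open>X\<close>, as \<open>extend_partial_cover\<close>
  requires.\<close>

definition good :: "'a set \<Rightarrow> 'a set \<Rightarrow> bool" where
  "good X Y \<longleftrightarrow> partial_cover E X Y \<and> (\<forall>A\<in>big. A \<inter> Y = {} \<longrightarrow> |A \<inter> X| <o kap)"

text \<open>If \<open>good X Y\<close>, then also \<open>good X' Y'\<close>, by the inclusion \<open>X' \<subseteq> X \<union> W\<close> and the last condition.\<close>

definition absorbs :: "'a set \<Rightarrow> 'a set \<Rightarrow> 'a set \<Rightarrow> 'a set \<Rightarrow> 'a set \<Rightarrow> 'a set \<Rightarrow> bool" where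
  "absorbs S X Y X' Y' W \<longleftrightarrow> partial_cover E X' Y' \<and> X \<subseteq> X' \<and> Y \<subseteq> Y' \<and> S \<subseteq> W \<and> |W| \<le>o |S| \<and>
     X' \<subseteq> X \<union> W \<and> (\<forall>A\<in>big. uncountable (A \<inter> W) \<longrightarrow> A \<inter> Y' \<noteq> {})"

text \<open>Otherwise the traces on the sets \<open>U j\<close> would be a chain of finite sets,
  whose union is countable.\<close>

lemma infinite_trace_if_uncountable:
  assumes mono: "\<And>i j. i \<in> S \<Longrightarrow> j \<in> underS ( |S| ) i \<Longrightarrow> U j \<subseteq> U i"
    and W: "W \<subseteq> (\<Union>j\<in>S. U j)" and unc: "uncountable (A \<inter> W)"
  shows "\<exists>j\<in>S. infinite (A \<inter> U j)"
proof (rule ccontr)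
  assume "\<not> ?thesis"
  then have fin: "finite (A \<inter> U j)" if "j \<in> S" for j using that by blast
  have chain: "C \<subseteq> D \<or> D \<subseteq> C" if CD: "C \<in> (\<lambda>j. A \<inter> U j) ` S" "D \<in> (\<lambda>j. A \<inter> U j) ` S" for C D
  proof -
    obtain i j where "i \<in> S" "j \<in> S" "C = A \<inter> U i" "D = A \<inter> U j" using CD by auto
    then show ?thesis using underS_card_of_total[of i S j] mono by blast
  qed
  have "countable (\<Union>j\<in>S. A \<inter> U j)"
    using chain fin by (intro countable_Union_chain_finite) auto
  moreover have "A \<inter> W \<subseteq> (\<Union>j\<in>S. A \<inter> U j)" using W by blast
  ultimately have "countable (A \<inter> W)" by (rule countable_subset[rotated])
  then show False using unc by blast
qed

text \<open>Stage \<open>i\<close> meets one edge \<open>B\<close>. If \<open>B\<close> is still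
  unmet, it differs from the fewer than \<open>kap\<close> edges treated before and meets each of
  them in a finite set. With the finite extra sets and the small trace on \<open>X\<close>, fewer
  than \<open>kap\<close> of its vertices are excluded, so it can be met.\<close>

lemma absorb_kap:
  assumes big: "big \<noteq> {}" and S: "|S| =o kap" and good: "good X Y"
  shows "\<exists>X' Y' W. absorbs S X Y X' Y' W"
proof -
  have S_unc: "uncountable S"
    by (rule uncountable_if_kap_ordLeq[OF ordIso_imp_ordLeq[OF ordIso_symmetric[OF S]]])
  then have S_inf: "infinite S" by (metis countable_finite)
  have card_big: "|A| =o |S|" if "A \<in> big" for A
    using that by (intro ordIso_transitive[OF card_edge ordIso_symmetric[OF S]]) (simp_all add: big_def)
  have "\<exists>t. t ` S = A" if "A \<in> big" for A
  proof -
    have "A \<noteq> {}" using that by (auto simp: big_def)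
    then show ?thesis using card_of_ordLeq2[of A S] ordIso_imp_ordLeq[OF card_big[OF that]] by simp
  qed
  \<comment> \<open>An edge has as many vertices as \<open>S\<close>, so adding whole edges would
    make the collected sets too large for the enumeration. Indexing each edge by \<open>S\<close>
    lets stage \<open>j\<close> reveal only the vertices with index up to \<open>j\<close>.\<close>
  then obtain \<tau> where \<tau>: "\<And>A. A \<in> big \<Longrightarrow> \<tau> A ` S = A" by metis
  let ?X = "\<lambda>q :: 'a set \<times> 'a set \<times> 'a set \<times> 'a set. fst q"
  let ?Y = "\<lambda>q :: 'a set \<times> 'a set \<times> 'a set \<times> 'a set. fst (snd q)"
  let ?F = "\<lambda>q :: 'a set \<times> 'a set \<times> 'a set \<times> 'a set. fst (snd (snd q))"
  \<comment> \<open>The treated edge is stored in the state because \<open>T\<close> may depend only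
    on \<open>f\<close>.\<close>
  let ?B = "\<lambda>q :: 'a set \<times> 'a set \<times> 'a set \<times> 'a set. snd (snd (snd q))"
  define XX where "XX f i = X \<union> (\<Union>j\<in>underS ( |S| ) i. ?X (f j))" for f i
  define YY where "YY f i = Y \<union> (\<Union>j\<in>underS ( |S| ) i. ?Y (f j))" for f i
  define T where "T f j = (\<Union>l\<in>under ( |S| ) j. insert l (?F (f l))) \<union>
    (\<lambda>(l, k). \<tau> (?B (f l)) k) ` (under ( |S| ) j \<times> under ( |S| ) j)" for f j
  define Q where "Q f i B q \<longleftrightarrow> partial_cover E (?X q) (?Y q) \<and> XX f i \<subseteq> ?X q \<and> YY f i \<subseteq> ?Y q \<and>
    ?X q \<subseteq> XX f i \<union> B \<union> ?F q \<and> finite (?F q) \<and> ?B q = B \<and> B \<inter> ?Y q \<noteq> {}" for f i B q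
  have QD: "partial_cover E (?X q) (?Y q)" "XX f i \<subseteq> ?X q" "YY f i \<subseteq> ?Y q"
    "?X q \<subseteq> XX f i \<union> B \<union> ?F q" "finite (?F q)" "?B q = B" "B \<inter> ?Y q \<noteq> {}" if "Q f i B q" for f i B q
    using that unfolding Q_def by simp_all
  have mono: "X \<subseteq> ?X (f i) \<and> Y \<subseteq> ?Y (f i) \<and> (\<forall>j\<in>underS ( |S| ) i. ?X (f j) \<subseteq> ?X (f i) \<and> ?Y (f j) \<subseteq> ?Y (f i))"
    if "Q f i B (f i)" for f i B
    using QD(2,3)[OF that] unfolding XX_def YY_def by blast
  have union: "partial_cover E (X \<union> (\<Union>j\<in>I. ?X (f j))) (Y \<union> (\<Union>j\<in>I. ?Y (f j)))"
    if I: "I \<subseteq> S" "\<And>j. j \<in> I \<Longrightarrow> Q f j (b j) (f j)" for f b I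
  proof (rule partial_cover_UN)
    show "partial_cover E X Y" using good by (simp add: good_def)
  next
    fix j assume "j \<in> I"
    then show "partial_cover E (?X (f j)) (?Y (f j)) \<and> X \<subseteq> ?X (f j) \<and> Y \<subseteq> ?Y (f j)"
      using QD(1)[OF I(2)] mono[OF I(2)] by simp
  next
    fix i j assume ij: "i \<in> I" "j \<in> I"
    then have "i = j \<or> i \<in> underS ( |S| ) j \<or> j \<in> underS ( |S| ) i"
      using I(1) by (intro underS_card_of_total) auto
    then show "?X (f i) \<subseteq> ?X (f j) \<and> ?Y (f i) \<subseteq> ?Y (f j) \<or> ?X (f j) \<subseteq> ?X (f i) \<and> ?Y (f j) \<subseteq> ?Y (f i)"
      using mono[OF I(2)[OF ij(1)]] mono[OF I(2)[OF ij(2)]] by auto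
  qed
  have bound: "?X (f i) \<subseteq> X \<union> (\<Union>l\<in>under ( |S| ) i. b l \<union> ?F (f l))"
    if i: "i \<in> S" "\<And>j. j \<in> under ( |S| ) i \<Longrightarrow> Q f j (b j) (f j)" for f b i
    using i
  proof (induction i rule: wf_induct_rule[OF wf_underS_card_of[of S]])
    case (1 i)
    have "?X (f j) \<subseteq> X \<union> (\<Union>l\<in>under ( |S| ) i. b l \<union> ?F (f l))" if j: "j \<in> underS ( |S| ) i" for j
    proof -
      have sub: "under ( |S| ) j \<subseteq> under ( |S| ) i"
        using j under_card_of_mono[of j S i] underS_card_of_subset_under[of S i] by blast
      then have "?X (f j) \<subseteq> X \<union> (\<Union>l\<in>under ( |S| ) j. b l \<union> ?F (f l))"
        using 1 j under_card_of_subset(2)[of S i] by (intro 1(1)) auto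
      then show ?thesis using sub by blast
    qed
    moreover have "?X (f i) \<subseteq> XX f i \<union> b i \<union> ?F (f i)"
      using QD(4)[OF 1(3)[OF under_card_of_self[OF 1(2)]]] .
    ultimately show ?case using under_card_of_self[OF 1(2)] unfolding XX_def by blast
  qed
  obtain f b where fb: "\<And>i. i \<in> S \<Longrightarrow> b i \<in> big \<and> Q f i (b i) (f i)"
    and all: "\<And>j A. j \<in> S \<Longrightarrow> A \<in> big \<Longrightarrow> |T f j| <o |S| \<Longrightarrow> infinite (A \<inter> T f j) \<Longrightarrow> \<exists>i\<in>S. b i = A"
  proof (rule bookkept_recursion[OF S_inf big, of T Q])
    fix f g :: "'a \<Rightarrow> 'a set \<times> 'a set \<times> 'a set \<times> 'a set" and j
    assume "\<And>l. l \<in> under ( |S| ) j \<Longrightarrow> f l = g l"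
    then show "T f j = T g j" unfolding T_def by (intro arg_cong2[of _ _ _ _ "(\<union>)"] SUP_cong image_cong) auto
  next
    fix f g :: "'a \<Rightarrow> 'a set \<times> 'a set \<times> 'a set \<times> 'a set" and i B q
    assume "\<And>l. l \<in> underS ( |S| ) i \<Longrightarrow> f l = g l"
    then have "XX f i = XX g i" "YY f i = YY g i" unfolding XX_def YY_def by auto
    then show "Q f i B q = Q g i B q" unfolding Q_def by simp
  next
    fix f b i B
    assume i: "i \<in> S" and B: "B \<in> big"
      and IH: "\<And>j. j \<in> underS ( |S| ) i \<Longrightarrow> b j \<in> big \<and> Q f j (b j) (f j)"
    have pc: "partial_cover E (XX f i) (YY f i)"
      unfolding XX_def YY_def using IH under_card_of_subset(2)[of S i] by (intro union) auto
    show "\<exists>q. Q f i B q"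
    proof (cases "B \<inter> YY f i = {}")
      case False
      then have "Q f i B (XX f i, YY f i, {}, B)" using pc by (simp add: Q_def)
      then show ?thesis by blast
    next
      case True
      let ?R = "\<Union>l\<in>underS ( |S| ) i. (B \<inter> b l) \<union> ?F (f l)"
      have "?X (f j) \<subseteq> X \<union> (\<Union>l\<in>underS ( |S| ) i. b l \<union> ?F (f l))" if j: "j \<in> underS ( |S| ) i" for j
      proof -
        have sub: "under ( |S| ) j \<subseteq> underS ( |S| ) i" using j by (rule under_card_of_subset_underS)
        have "?X (f j) \<subseteq> X \<union> (\<Union>l\<in>under ( |S| ) j. b l \<union> ?F (f l))"
          using j sub IH under_card_of_subset(2)[of S i] by (intro bound) auto
        then show ?thesis using sub by blast
      qed
      then have "B \<inter> XX f i \<subseteq> (B \<inter> X) \<union> ?R" unfolding XX_def by blast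
      moreover have "|B \<inter> X| <o |S|"
      proof (rule ordLess_ordIso_trans[OF _ ordIso_symmetric[OF S]])
        have "B \<inter> Y = {}" using True unfolding YY_def by blast
        then show "|B \<inter> X| <o kap" using good B unfolding good_def by simp
      qed
      moreover have "|?R| <o |S|"
      proof (rule card_UN_countable_ordLess[OF S_unc])
        show "|underS ( |S| ) i| <o |S|"
          using card_of_underS[OF card_of_Card_order, of i S] i by (simp add: Field_card_of)
        fix l assume l: "l \<in> underS ( |S| ) i"
        have "b l \<inter> ?Y (f l) \<noteq> {}" using QD(7) IH[OF l] by blast
        then have "b l \<inter> YY f i \<noteq> {}" using l unfolding YY_def by blast
        then have "b l \<noteq> B" using True by blast
        then have "finite (B \<inter> b l)" using almost_disjoint B IH[OF l] unfolding big_def by blast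
        moreover have "finite (?F (f l))" using QD(5) IH[OF l] by blast
        ultimately show "countable (B \<inter> b l \<union> ?F (f l))" by (intro countable_finite) simp
      qed
      ultimately have "|B \<inter> XX f i| <o |S|"
        by (rule ordLeq_ordLess_trans[OF card_of_mono1 card_of_Un_ordLess_infinite[OF S_inf]])
      then have "B \<inter> XX f i \<noteq> B"
        using not_ordLess_ordIso[of "|B|" "|S|"] card_big[OF B] by force
      then have "\<not> B \<subseteq> XX f i" by blast
      then obtain X' Y' F where "partial_cover E X' Y'" "XX f i \<subseteq> X'" "YY f i \<subseteq> Y'"
        "X' \<subseteq> XX f i \<union> B \<union> F" "finite F" "B \<inter> Y' \<noteq> {}"
        using extend_partial_cover[OF pc _ True] B unfolding big_def by auto
      then have "Q f i B (X', Y', F, B)" by (simp add: Q_def)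
      then show ?thesis by blast
    qed
  qed blast
  let ?W = "\<Union>i\<in>S. insert i (b i \<union> ?F (f i))"
  have b_eq: "?B (f i) = b i" "finite (?F (f i))" "b i \<inter> ?Y (f i) \<noteq> {}" if "i \<in> S" for i
    using fb[OF that] QD(5-7) by blast+
  have T_less: "|T f j| <o |S|" if j: "j \<in> S" for j
  proof -
    have "|under ( |S| ) j| <o |S|" using card_of_under_ordLess[OF S_inf j] .
    then have "|under ( |S| ) j \<times> under ( |S| ) j| <o |S|"
      by (rule card_Times_self_ordLess[OF S_inf])
    then have "|(\<lambda>(l, k). \<tau> (?B (f l)) k) ` (under ( |S| ) j \<times> under ( |S| ) j)| <o |S|"
      by (rule ordLeq_ordLess_trans[OF card_of_image])
    moreover have "|\<Union>l\<in>under ( |S| ) j. insert l (?F (f l))| <o |S|"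
    proof (rule card_UN_countable_ordLess[OF S_unc card_of_under_ordLess[OF S_inf j]])
      fix l assume "l \<in> under ( |S| ) j"
      then have "finite (?F (f l))" using b_eq(2) under_card_of_subset(1)[of S j] by blast
      then show "countable (insert l (?F (f l)))" by (simp add: countable_finite)
    qed
    ultimately show ?thesis unfolding T_def by (intro card_of_Un_ordLess_infinite[OF S_inf])
  qed
  have T_mono: "T f j \<subseteq> T f i" if "j \<in> underS ( |S| ) i" for i j
  proof -
    have "under ( |S| ) j \<subseteq> under ( |S| ) i"
      using that under_card_of_mono[of j S i] underS_card_of_subset_under[of S i] by blast
    then show ?thesis unfolding T_def by (intro Un_mono UN_mono image_mono Sigma_mono) auto
  qed
  have W_T: "?W \<subseteq> (\<Union>j\<in>S. T f j)"
  proof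
    fix x assume "x \<in> ?W"
    then obtain i where i: "i \<in> S" "x = i \<or> x \<in> ?F (f i) \<or> x \<in> b i" by blast
    show "x \<in> (\<Union>j\<in>S. T f j)"
    proof (cases "x \<in> b i")
      case True
      then obtain k where k: "k \<in> S" "x = \<tau> (b i) k" using \<tau> fb[OF i(1)] by blast
      \<comment> \<open>The later of the stage \<open>i\<close> of the edge and the index
        \<open>k\<close> of the vertex is a stage at which this vertex is revealed.\<close>
      have "i \<in> under ( |S| ) k \<or> k \<in> under ( |S| ) i"
        using underS_card_of_total[OF i(1) k(1)] under_card_of_self[OF i(1)]
          subsetD[OF underS_card_of_subset_under] by metis
      then obtain j where j: "j \<in> S" "(i, k) \<in> under ( |S| ) j \<times> under ( |S| ) j"
        using under_card_of_self[OF i(1)] under_card_of_self[OF k(1)] i(1) k(1) by auto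
      have "x = (\<lambda>(l, k). \<tau> (?B (f l)) k) (i, k)" using k(2) b_eq(1)[OF i(1)] by simp
      then have "x \<in> T f j" unfolding T_def using j(2) by (intro UnI2 image_eqI)
      then show ?thesis using j by blast
    next
      case False
      then have "x \<in> T f i" unfolding T_def using i under_card_of_self[OF i(1)] by blast
      then show ?thesis using i by blast
    qed
  qed
  have "absorbs S X Y (X \<union> (\<Union>i\<in>S. ?X (f i))) (Y \<union> (\<Union>i\<in>S. ?Y (f i))) ?W"
    unfolding absorbs_def
  proof (intro conjI ballI impI)
    show "partial_cover E (X \<union> (\<Union>i\<in>S. ?X (f i))) (Y \<union> (\<Union>i\<in>S. ?Y (f i)))"
      using fb by (intro union) auto
    show "|?W| \<le>o |S|"
    proof (rule card_of_UNION_ordLeq_infinite[OF S_inf card_of_mono1[OF order_refl]], rule ballI)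
      fix i assume i: "i \<in> S"
      have "|b i| \<le>o |S|" by (intro ordIso_imp_ordLeq card_big) (use fb[OF i] in simp)
      moreover have "|insert i (?F (f i))| \<le>o |S|"
        using b_eq[OF i] S_inf
        by (intro ordLess_imp_ordLeq finite_ordLess_infinite) (simp_all add: Field_card_of card_of_well_order_on)
      ultimately have "|insert i (?F (f i)) \<union> b i| \<le>o |S|"
        using S_inf by (intro card_of_Un_ordLeq_infinite_Field) (simp_all add: Field_card_of card_of_card_order_on)
      then show "|insert i (b i \<union> ?F (f i))| \<le>o |S|" by (simp add: Un_commute)
    qed
    show "X \<union> (\<Union>i\<in>S. ?X (f i)) \<subseteq> X \<union> ?W"
    proof -
      have "?X (f i) \<subseteq> X \<union> ?W" if i: "i \<in> S" for i
        using bound[OF i, of f b] fb under_card_of_subset(1)[of S i] by blast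
      then show ?thesis by blast
    qed
    fix A assume A: "A \<in> big" "uncountable (A \<inter> ?W)"
    obtain j where "j \<in> S" "infinite (A \<inter> T f j)"
      using infinite_trace_if_uncountable[OF T_mono W_T A(2)] by blast
    then obtain i where "i \<in> S" "b i = A" using all[OF _ A(1) T_less] by blast
    then show "A \<inter> (Y \<union> (\<Union>i\<in>S. ?Y (f i))) \<noteq> {}" using b_eq(3) by blast
  qed blast+
  then show ?thesis by blast
qed

text \<open>Here mere uncountability of \<open>kap\<close> would not suffice: such a union may have
  size omega_1.\<close>

lemma card_chain_countable_ordLess:
  assumes "\<And>C D. C \<in> \<C> \<Longrightarrow> D \<in> \<C> \<Longrightarrow> C \<subseteq> D \<or> D \<subseteq> C" "\<And>C. C \<in> \<C> \<Longrightarrow> countable C"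
  shows "|\<Union>\<C>| <o kap"
proof -
  have "|\<Union>\<C>| \<le>o cardSuc natLeq"
    using assms by (intro card_Union_chain_ordLeq_cardSuc natLeq_Card_order)
      (simp_all add: Field_natLeq countable_card_le_natLeq)
  then show ?thesis using kap(2) by (rule ordLeq_ordLess_trans)
qed

text \<open>Stage \<open>i\<close> applies the induction hypothesis to everything collected so far
  together with \<open>i\<close> and the scheduled edge. The edge brings this set up to size
  \<open>kap\<close>, and \<open>stage_bound\<close> keeps it below \<open>|S|\<close>.\<close>

lemma absorb_step:
  assumes big: "big \<noteq> {}" and S: "kap <o |S|" and good: "good X Y"
    and smaller: "\<And>S' X Y. kap \<le>o |S'| \<Longrightarrow> |S'| <o |S| \<Longrightarrow> good X Y \<Longrightarrow> \<exists>X' Y' W. absorbs S' X Y X' Y' W"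
  shows "\<exists>X' Y' W. absorbs S X Y X' Y' W"
proof -
  have S_unc: "uncountable S" by (rule uncountable_if_kap_ordLeq[OF ordLess_imp_ordLeq[OF S]])
  then have S_inf: "infinite S" by (metis countable_finite)
  obtain B0 where B0: "B0 \<in> big" using big by blast
  have card_big: "|A| =o kap" if "A \<in> big" for A
    using that card_edge by (simp add: big_def)
  have card_big_eq: "|A| \<le>o |B|" if "A \<in> big" "B \<in> big" for A B
    by (rule ordIso_imp_ordLeq[OF ordIso_transitive[OF card_big[OF that(1)] ordIso_symmetric[OF card_big[OF that(2)]]]])
  let ?X = "\<lambda>q :: 'a set \<times> 'a set \<times> 'a set. fst q"
  let ?Y = "\<lambda>q :: 'a set \<times> 'a set \<times> 'a set. fst (snd q)"
  let ?W = "\<lambda>q :: 'a set \<times> 'a set \<times> 'a set. snd (snd q)"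
  define XX where "XX f i = X \<union> (\<Union>j\<in>underS ( |S| ) i. ?X (f j))" for f i
  define YY where "YY f i = Y \<union> (\<Union>j\<in>underS ( |S| ) i. ?Y (f j))" for f i
  define WW where "WW f i = (\<Union>j\<in>underS ( |S| ) i. ?W (f j))" for f i
  \<comment> \<open>Since \<open>|S|\<close> may be singular, knowing that each earlier set is
    smaller than \<open>|S|\<close> would not bound their union; an explicit bound monotone in
    \<open>i\<close> does. Adjoining \<open>B0\<close> makes it at least \<open>kap\<close> even for
    short initial segments.\<close>
  define stage_bound where "stage_bound i = under ( |S| ) i \<union> B0" for i
  define T where "T f j = ?W (f j)" for f :: "'a \<Rightarrow> 'a set \<times> 'a set \<times> 'a set" and j :: 'a
  define Q where "Q f i B q \<longleftrightarrow> partial_cover E (?X q) (?Y q) \<and> XX f i \<subseteq> ?X q \<and> YY f i \<subseteq> ?Y q \<and>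
    insert i (WW f i \<union> B) \<subseteq> ?W q \<and> |?W q| \<le>o |stage_bound i| \<and> ?X q \<subseteq> X \<union> ?W q \<and>
    (\<forall>A\<in>big. uncountable (A \<inter> ?W q) \<longrightarrow> A \<inter> ?Y q \<noteq> {})" for f i B q
  have QD: "partial_cover E (?X q) (?Y q)" "XX f i \<subseteq> ?X q" "YY f i \<subseteq> ?Y q"
    "insert i (WW f i \<union> B) \<subseteq> ?W q" "|?W q| \<le>o |stage_bound i|" "?X q \<subseteq> X \<union> ?W q"
    "\<And>A. A \<in> big \<Longrightarrow> uncountable (A \<inter> ?W q) \<Longrightarrow> A \<inter> ?Y q \<noteq> {}" if "Q f i B q" for f i B q
    using that unfolding Q_def by simp_all
  have stage_bound_inf: "infinite (stage_bound i)" for i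
    using B0 by (simp add: stage_bound_def big_def)
  have stage_bound_less: "|stage_bound i| <o |S|" if "i \<in> S" for i
    unfolding stage_bound_def
    by (rule card_of_Un_ordLess_infinite[OF S_inf card_of_under_ordLess[OF S_inf that]
          ordIso_ordLess_trans[OF card_big[OF B0] S]])
  have mono: "X \<subseteq> ?X (f i) \<and> Y \<subseteq> ?Y (f i) \<and>
      (\<forall>j\<in>underS ( |S| ) i. ?X (f j) \<subseteq> ?X (f i) \<and> ?Y (f j) \<subseteq> ?Y (f i) \<and> ?W (f j) \<subseteq> ?W (f i))"
    if "Q f i B (f i)" for f i B
    using QD(2-4)[OF that] unfolding XX_def YY_def WW_def by blast
  have chain: "?X (f i) \<subseteq> ?X (f j) \<and> ?Y (f i) \<subseteq> ?Y (f j) \<and> ?W (f i) \<subseteq> ?W (f j) \<or>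
      ?X (f j) \<subseteq> ?X (f i) \<and> ?Y (f j) \<subseteq> ?Y (f i) \<and> ?W (f j) \<subseteq> ?W (f i)"
    if I: "I \<subseteq> S" "\<And>j. j \<in> I \<Longrightarrow> Q f j (b j) (f j)" and ij: "i \<in> I" "j \<in> I" for f b I i j
  proof -
    have "i = j \<or> i \<in> underS ( |S| ) j \<or> j \<in> underS ( |S| ) i"
      using I(1) ij by (intro underS_card_of_total) auto
    then show ?thesis using mono[OF I(2)[OF ij(1)]] mono[OF I(2)[OF ij(2)]] by auto
  qed
  have union: "partial_cover E (X \<union> (\<Union>j\<in>I. ?X (f j))) (Y \<union> (\<Union>j\<in>I. ?Y (f j)))"
    if I: "I \<subseteq> S" "\<And>j. j \<in> I \<Longrightarrow> Q f j (b j) (f j)" for f b I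
  proof (rule partial_cover_UN)
    show "partial_cover E X Y" using good by (simp add: good_def)
  next
    fix j assume "j \<in> I"
    then show "partial_cover E (?X (f j)) (?Y (f j)) \<and> X \<subseteq> ?X (f j) \<and> Y \<subseteq> ?Y (f j)"
      using QD(1)[OF I(2)] mono[OF I(2)] by simp
  next
    fix i j assume ij: "i \<in> I" "j \<in> I"
    then show "?X (f i) \<subseteq> ?X (f j) \<and> ?Y (f i) \<subseteq> ?Y (f j) \<or> ?X (f j) \<subseteq> ?X (f i) \<and> ?Y (f j) \<subseteq> ?Y (f i)"
      using chain[OF I ij] by blast
  qed
  obtain f b where fb: "\<And>i. i \<in> S \<Longrightarrow> b i \<in> big \<and> Q f i (b i) (f i)"
    and all: "\<And>j A. j \<in> S \<Longrightarrow> A \<in> big \<Longrightarrow> |T f j| <o |S| \<Longrightarrow> infinite (A \<inter> T f j) \<Longrightarrow> \<exists>i\<in>S. b i = A"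
  proof (rule bookkept_recursion[OF S_inf big, of T Q])
    fix f g :: "'a \<Rightarrow> 'a set \<times> 'a set \<times> 'a set" and j
    assume "j \<in> S" "\<And>l. l \<in> under ( |S| ) j \<Longrightarrow> f l = g l"
    then show "T f j = T g j" by (simp add: T_def under_card_of_self)
  next
    fix f g :: "'a \<Rightarrow> 'a set \<times> 'a set \<times> 'a set" and i B q
    assume "\<And>l. l \<in> underS ( |S| ) i \<Longrightarrow> f l = g l"
    then have "XX f i = XX g i" "YY f i = YY g i" "WW f i = WW g i"
      unfolding XX_def YY_def WW_def by auto
    then show "Q f i B q = Q g i B q" unfolding Q_def by simp
  next
    fix f b i B
    assume i: "i \<in> S" and B: "B \<in> big"
      and IH: "\<And>j. j \<in> underS ( |S| ) i \<Longrightarrow> b j \<in> big \<and> Q f j (b j) (f j)"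
    note sub = under_card_of_subset(2)[of S i]
    have IHQ: "Q f j (b j) (f j)" if "j \<in> underS ( |S| ) i" for j using IH[OF that] by simp
    \<comment> \<open>An edge unmet so far has countable trace on every earlier
      \<open>?W (f j)\<close>. These traces form a chain, so beyond its trace on \<open>X\<close>
      the edge has lost at most omega_1 vertices.\<close>
    have good': "good (XX f i) (YY f i)"
      unfolding good_def
    proof (intro conjI ballI impI)
      show "partial_cover E (XX f i) (YY f i)"
        unfolding XX_def YY_def using sub IHQ by (rule union)
      fix A assume A: "A \<in> big" "A \<inter> YY f i = {}"
      let ?\<C> = "(\<lambda>j. A \<inter> ?W (f j)) ` underS ( |S| ) i"
      have "|\<Union>?\<C>| <o kap"
      proof (rule card_chain_countable_ordLess)
        fix C D assume "C \<in> ?\<C>" "D \<in> ?\<C>"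
        then obtain k l where "k \<in> underS ( |S| ) i" "l \<in> underS ( |S| ) i"
          "C = A \<inter> ?W (f k)" "D = A \<inter> ?W (f l)" by auto
        then show "C \<subseteq> D \<or> D \<subseteq> C" using chain[OF sub IHQ, of k l] by blast
      next
        fix C assume "C \<in> ?\<C>"
        then obtain j where j: "j \<in> underS ( |S| ) i" "C = A \<inter> ?W (f j)" by auto
        have "A \<inter> ?Y (f j) = {}" using A(2) j(1) unfolding YY_def by blast
        then show "countable C" using QD(7)[OF IHQ[OF j(1)] A(1)] j(2) by blast
      qed
      moreover have "|A \<inter> X| <o kap"
      proof -
        have "A \<inter> Y = {}" using A(2) unfolding YY_def by blast
        then show ?thesis using good A(1) unfolding good_def by simp
      qed
      ultimately have "|A \<inter> X \<union> \<Union>?\<C>| <o kap"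
        by (intro card_of_Un_ordLess_infinite_Field[OF infinite_kap kap(1)])
      moreover have "A \<inter> XX f i \<subseteq> A \<inter> X \<union> \<Union>?\<C>"
      proof -
        have "?X (f j) \<subseteq> X \<union> ?W (f j)" if "j \<in> underS ( |S| ) i" for j using QD(6)[OF IHQ[OF that]] .
        then show ?thesis unfolding XX_def by blast
      qed
      ultimately show "|A \<inter> XX f i| <o kap" by (rule ordLeq_ordLess_trans[OF card_of_mono1, rotated])
    qed
    let ?S = "insert i (WW f i \<union> B)"
    have "|B| \<le>o |?S|" by (rule card_of_mono1) blast
    then have S_kap: "kap \<le>o |?S|" by (rule ordIso_ordLeq_trans[OF ordIso_symmetric[OF card_big[OF B]]])
    have S_bound: "|?S| \<le>o |stage_bound i|"
    proof -
      have "|WW f i| \<le>o |stage_bound i|"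
        unfolding WW_def
      proof (rule card_of_UNION_ordLeq_infinite[OF stage_bound_inf], safe)
        show "|underS ( |S| ) i| \<le>o |stage_bound i|"
          unfolding stage_bound_def using underS_card_of_subset_under[of S i] by (intro card_of_mono1) blast
        fix j assume j: "j \<in> underS ( |S| ) i"
        have "under ( |S| ) j \<subseteq> under ( |S| ) i"
          using under_card_of_mono[OF subsetD[OF underS_card_of_subset_under j]] .
        then have "|stage_bound j| \<le>o |stage_bound i|" unfolding stage_bound_def by (intro card_of_mono1) blast
        then show "|?W (f j)| \<le>o |stage_bound i|" by (rule ordLeq_transitive[OF QD(5)[OF IHQ[OF j]]])
      qed
      moreover have "|B| \<le>o |stage_bound i|"
        unfolding stage_bound_def by (rule ordLeq_transitive[OF card_big_eq[OF B B0] card_of_mono1]) blast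
      moreover have "|{i}| \<le>o |stage_bound i|"
        using under_card_of_self[OF i] unfolding stage_bound_def by (intro card_of_mono1) blast
      ultimately have "|{i} \<union> (WW f i \<union> B)| \<le>o |stage_bound i|"
        using stage_bound_inf by (intro card_of_Un_ordLeq_infinite_Field) (simp_all add: Field_card_of card_of_card_order_on)
      then show ?thesis by simp
    qed
    obtain X' Y' W where abs: "absorbs ?S (XX f i) (YY f i) X' Y' W"
      using smaller[OF S_kap ordLeq_ordLess_trans[OF S_bound stage_bound_less[OF i]] good'] by blast
    have "X' \<subseteq> XX f i \<union> W" "WW f i \<subseteq> W" using abs unfolding absorbs_def by blast+
    moreover have "XX f i \<subseteq> X \<union> WW f i"
      using QD(6)[OF IHQ] unfolding XX_def WW_def by blast
    ultimately have "X' \<subseteq> X \<union> W" by blast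
    moreover have "|W| \<le>o |stage_bound i|"
      using abs unfolding absorbs_def by (intro ordLeq_transitive[OF _ S_bound]) simp
    ultimately have "Q f i B (X', Y', W)"
      using abs unfolding Q_def absorbs_def by simp
    then show "\<exists>q. Q f i B q" by blast
  qed blast
  let ?U = "\<Union>i\<in>S. ?W (f i)"
  have fQ: "Q f i (b i) (f i)" if "i \<in> S" for i using fb[OF that] by simp
  have "absorbs S X Y (X \<union> (\<Union>i\<in>S. ?X (f i))) (Y \<union> (\<Union>i\<in>S. ?Y (f i))) ?U"
    unfolding absorbs_def
  proof (intro conjI ballI impI)
    show "partial_cover E (X \<union> (\<Union>i\<in>S. ?X (f i))) (Y \<union> (\<Union>i\<in>S. ?Y (f i)))"
      using fQ by (rule union[OF order_refl])
    show "S \<subseteq> ?U" using QD(4)[OF fQ] by blast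
    show "|?U| \<le>o |S|"
      using ordLeq_transitive[OF QD(5)[OF fQ] ordLess_imp_ordLeq[OF stage_bound_less]]
      by (intro card_of_UNION_ordLeq_infinite[OF S_inf card_of_mono1[OF order_refl]]) blast
    show "X \<union> (\<Union>i\<in>S. ?X (f i)) \<subseteq> X \<union> ?U" using QD(6)[OF fQ] by blast
    fix A assume A: "A \<in> big" "uncountable (A \<inter> ?U)"
    have "\<exists>j\<in>S. infinite (A \<inter> ?W (f j))"
      using A(2)
    proof (rule infinite_trace_if_uncountable[rotated 2])
      show "?W (f j) \<subseteq> ?W (f i)" if "i \<in> S" "j \<in> underS ( |S| ) i" for i j
        using mono[OF fQ[OF that(1)]] that(2) by blast
    qed blast
    then obtain j where j: "j \<in> S" "infinite (A \<inter> T f j)" unfolding T_def by blast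
    have "|T f j| <o |S|"
      unfolding T_def by (rule ordLeq_ordLess_trans[OF QD(5)[OF fQ[OF j(1)]] stage_bound_less[OF j(1)]])
    then obtain i where i: "i \<in> S" "b i = A" using all[OF j(1) A(1) _ j(2)] by blast
    \<comment> \<open>Scheduling \<open>A\<close> at stage \<open>i\<close> puts it inside
      \<open>?W (f i)\<close>; its trace there is then uncountable, which forces it to be met at
      that stage.\<close>
    then have "A \<inter> ?W (f i) = A" using QD(4)[OF fQ[OF i(1)]] by blast
    moreover have "uncountable A"
      by (rule uncountable_if_kap_ordLeq[OF ordIso_imp_ordLeq[OF ordIso_symmetric[OF card_big[OF A(1)]]]])
    ultimately have "A \<inter> ?Y (f i) \<noteq> {}" using QD(7)[OF fQ[OF i(1)] A(1)] by simp
    then show "A \<inter> (Y \<union> (\<Union>i\<in>S. ?Y (f i))) \<noteq> {}" using i(1) by blast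
  qed blast+
  then show ?thesis by blast
qed

lemma absorb:
  assumes big: "big \<noteq> {}" and "kap \<le>o |S|" "good X Y"
  shows "\<exists>X' Y' W. absorbs S X Y X' Y' W"
  using assms(2,3)
proof (induction S arbitrary: X Y rule: wf_induct_rule[OF wf_inv_image[OF wf_ordLess, of card_of]])
  case (1 S)
  show ?case
  proof (cases "kap <o |S|")
    case True
    show ?thesis
      using 1(1)[simplified] by (intro absorb_step[OF big True 1(3)]) auto
  next
    case False
    then have "|S| =o kap"
      using 1(2) ordLeq_iff_ordLess_or_ordIso[of kap "|S|"] ordIso_symmetric[of kap "|S|"] by blast
    then show ?thesis by (rule absorb_kap[OF big _ 1(3)])
  qed
qed

text \<open>Absorbing the whole vertex set suffices, because the trace of an infinite edge on
  \<open>W\<close> is then the edge itself. One infinite edge already makes the vertex set large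
  enough for \<open>absorb\<close>.\<close>

lemma ex_minimal_vertex_cover:
  assumes "{} \<notin> E"
  shows "\<exists>Z. minimal_vertex_cover E Z"
proof (cases "big = {}")
  case True
  have "partial_cover E {} {}" using assms by (auto simp: partial_cover_def)
  then show ?thesis
    by (rule minimal_vertex_cover_if_partial_cover) (use True in \<open>auto simp: big_def\<close>)
next
  case False
  have start: "good {} {}"
  proof -
    have "|{} :: 'a set| <o kap"
      using kap(1) infinite_kap by (intro finite_ordLess_infinite) (auto simp: Field_card_of card_of_well_order_on intro: card_order_on_well_order_on)
    then show ?thesis using assms by (auto simp: good_def partial_cover_def)
  qed
  obtain A where A: "A \<in> big" using False by blast
  then have "|A| \<le>o |\<Union>E|" by (intro card_of_mono1) (auto simp: big_def)
  moreover have "kap =o |A|" using A card_edge ordIso_symmetric[of "|A|" kap] by (simp add: big_def)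
  ultimately have "kap \<le>o |\<Union>E|" by (rule ordIso_ordLeq_trans[rotated])
  then obtain X Y W where abs: "absorbs (\<Union>E) {} {} X Y W" using absorb[OF False _ start] by blast
  show ?thesis
  proof (rule minimal_vertex_cover_if_partial_cover)
    show "partial_cover E X Y" using abs by (simp add: absorbs_def)
    fix B assume B: "B \<in> E" "infinite B"
    then have "uncountable B"
      by (intro uncountable_if_kap_ordLeq[OF ordIso_imp_ordLeq[OF ordIso_symmetric]] card_edge)
    moreover have "B \<inter> W = B" using abs B(1) unfolding absorbs_def by blast
    ultimately show "B \<inter> Y \<noteq> {}" using abs B unfolding absorbs_def big_def by simp
  qed
qed

end

section \<open>Instantiating the construction under GCH\<close>

text \<open>The hypothesis concerns sets of elements of \<open>'a set\<close>, so \<open>U\<close>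
  is first copied there as a set of singletons.\<close>

lemma card_of_Pow_ordLeq_if_GCH:
  fixes U :: "'a set"
  assumes "GCH TYPE('a set)" and U: "infinite U" "|U| <o |S|"
  shows "|Pow U| \<le>o |S|"
proof -
  let ?U = "(\<lambda>u. {u}) ` U"
  have bij: "bij_betw (\<lambda>u. {u}) U ?U" by (rule inj_on_imp_bij_betw) (simp add: inj_on_def)
  then have "infinite ?U" using U(1) bij_betw_finite by blast
  then have "|Pow ?U| =o cardSuc |?U|" using assms(1) by (simp add: GCH_def)
  then have "|Pow U| =o cardSuc |?U|"
    by (rule ordIso_transitive[OF card_of_ordIsoI[OF bij_betw_Pow[OF bij]]])
  moreover have "cardSuc |?U| \<le>o |S|"
    by (rule cardSuc_least[OF card_of_Card_order card_of_Card_order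
          ordIso_ordLess_trans[OF ordIso_symmetric[OF card_of_ordIsoI[OF bij]] U(2)]])
  ultimately show ?thesis by (rule ordIso_ordLeq_trans)
qed

theorem theorem1p2:
  fixes kap lam :: "'a rel" and E :: "'a set set"
  assumes "GCH TYPE('a set)"
    and "Card_order kap" and "Card_order lam"
    and "aleph2 \<le>o kap" and "kap \<le>o lam"
    and "hypergraph E"
    and "E \<subseteq> subsets_of_size (Field lam) (finite_cardinals \<union> {kap})"
    and "property_C ctwo natLeq E"
  shows "\<exists>Y. minimal_vertex_cover E Y"
proof -
  interpret almost_disjoint_hypergraph E kap
  proof
    show "Card_order kap" by fact
    show "cardSuc natLeq <o kap"
      using ordLess_ordLeq_trans[OF cardSuc_greater[OF cardSuc_Card_order[OF natLeq_Card_order]]]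
        assms(4) unfolding aleph2_def .
    show "|A| =o kap" if A: "A \<in> E" "infinite A" for A
    proof -
      obtain c where c: "c \<in> finite_cardinals \<union> {kap}" "|A| =o c"
        using assms(7) A(1) unfolding subsets_of_size_def by blast
      have "c \<notin> finite_cardinals"
        using A(2) card_of_ordIso_finite_Field[OF _ ordIso_symmetric[OF c(2)]]
        by (auto simp: finite_cardinals_def)
      then show ?thesis using c by simp
    qed
    show "finite (A \<inter> B)" if AB: "A \<in> E" "B \<in> E" "A \<noteq> B" for A B
    proof -
      \<comment> \<open>The cardinal \<open>ctwo\<close> is by definition that of the type
        \<open>bool\<close>.\<close>
      have "\<exists>h. bij_betw h {A, B} (UNIV :: bool set)"
        using AB(3) by (intro finite_same_card_bij) auto
      then have two: "|{A, B}| =o ctwo" unfolding ctwo_def using card_of_ordIso by blast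
      have "{A, B} \<subseteq> E" using AB by simp
      then have "|\<Inter>{A, B}| <o natLeq"
        by (rule spec[OF assms(8)[unfolded property_C_def], THEN mp, OF conjI, OF _ two])
      then show ?thesis using finite_iff_ordLess_natLeq[of "A \<inter> B"] by simp
    qed
    show "|Pow U| \<le>o |S|" if "infinite U" "|U| <o |S|" for U S :: "'a set"
      using assms(1) that by (rule card_of_Pow_ordLeq_if_GCH)
  qed
  show ?thesis using ex_minimal_vertex_cover assms(6) by (simp add: hypergraph_def)
qed

end
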